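(* Let $\Lambda\subseteq\mathbb{Z}_{\ge 0}\times\mathbb{Z}_{\ge 0}$ contain at least one element $(s,d)$ with $d$ even. Let $(\alpha_n)$ be a sequence of integers such that $0<\alpha_n<n/2$ for all sufficiently large $n$ and $\alpha_n\to\infty$ as $n\to\infty$. For each $n$, let $S_n$ be a uniform random subset of $[0,n]$. If $(k_n)$ is a sequence of integers satisfying $\alpha_n<k_n<n-\alpha_n$ for all sufficiently large $n$, then $$\lim_{n\to\infty}\mathbb{P}(k_n\in S_n\mid\lambda(S_n)\in\Lambda)=\frac12.$$
   Context: $[a,b]$ denotes the set of integers $\{a,a+1,\dots,b\}$ (empty if $a>b$). For a finite set $S$ of integers, $S+S=\{s_1+s_2 : s_1,s_2\in S\}$ and $S-S=\{s_1-s_2 : s_1,s_2\in S\}$. For $S\subseteq[0,n]$, $\lambda(S)=\lambda_n(S)=(2n+1-|S+S|,\;2n+1-|S-S|)$. Under the hypothesis on $\Lambda$, the probability $\mathbb{P}(\lambda(S_n)\in\Lambda)$ tends to a positive limit, so the conditional probability is defined for all large $n$. *)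

theory Defs
  imports "HOL-Probability.Probability" "HOL-Library.Set_Algebras"
begin

(* On sets, S + S is the sumset (Set_Algebras), but S - S is the set difference,
   so the set of differences needs a definition of its own. *)
definition diffset :: "int set \<Rightarrow> int set" where
  "diffset S = {s1 - s2 | s1 s2. s1 \<in> S \<and> s2 \<in> S}"

(* Integer-valued, so that the subtractions do not truncate; both components are
   nonnegative whenever S is a subset of {0..int n}. *)
definition lambda_pair :: "nat \<Rightarrow> int set \<Rightarrow> int \<times> int" where
  "lambda_pair n S =
     (2 * int n + 1 - int (card (S + S)), 2 * int n + 1 - int (card (diffset S)))"

definition random_subset :: "nat \<Rightarrow> int set pmf" where
  "random_subset n = pmf_of_set (Pow {0..int n})"

end

(* Call S filled (up to a) if S + S contains [a, 2n - a] and S - S contains [0, n - a]. Disjoint pairs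
   of summands show that a random subset of [0,n] fails this with probability O((7/8)^a), uniformly
   in n. Adding a point k of [a, n - a] to a filled set changes neither S + S nor S - S, so
   toggling k almost matches the sets with lambda in Lambda that contain k with those that do not,
   and the discrepancy is O((7/8)^alpha_n).

   It remains to bound P(lambda(S) = (s,d)) from below for some (s,d) in Lambda with d even. When
   the middle of S is filled, lambda(S) only depends on the two ends of S, so one needs cofinite sets
   A, B of naturals such that A + A and B + B miss s numbers altogether and A + B misses d/2. Both
   ends are then prescribed by A and B at the cost of a constant factor. *)
theory Submission
  imports Defs
begin

subsection \<open>Random sets are filled in the middle\<close>

text \<open>The hypotheses make the pairs \<open>{i, f i}\<close> disjoint, and each pair is left
  with 3 of its 4 possible traces. The induction removes one pair from \<open>U\<close>; the powers
  of 4 stand on the left to avoid division.\<close>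

lemma card_avoiding_pairs_le:
  assumes "finite U" "I \<subseteq> U" "f ` I \<subseteq> U" "inj_on f I" "f ` I \<inter> I = {}"
  shows "4 ^ card I * card {S \<in> Pow U. \<forall>i\<in>I. \<not> (i \<in> S \<and> f i \<in> S)} \<le> 3 ^ card I * 2 ^ card U"
proof -
  have "finite I" using assms finite_subset by blast
  then show ?thesis using assms
  proof (induction I arbitrary: U rule: finite_induct)
    case empty
    then show ?case by (simp add: card_Pow flip: Pow_def)
  next
    case (insert i I)
    define V where "V = U - {i, f i}"
    define F where "F = {S \<in> Pow V. \<forall>i\<in>I. \<not> (i \<in> S \<and> f i \<in> S)}"
    define G where "G = {S \<in> Pow U. \<forall>i\<in>insert i I. \<not> (i \<in> S \<and> f i \<in> S)}"
    have ne: "f i \<noteq> i" using insert.prems by auto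
    have finV: "finite V" using insert.prems by (simp add: V_def)
    have IH: "4 ^ card I * card F \<le> 3 ^ card I * 2 ^ card V"
      unfolding F_def
    proof (rule insert.IH)
      show "I \<subseteq> V" "f ` I \<subseteq> V" "inj_on f I" "f ` I \<inter> I = {}"
        using insert.prems insert.hyps by (auto simp: V_def inj_on_def)
    qed (rule finV)
    have cU: "card U = card V + 2"
    proof -
      have "card {i, f i} = 2" using ne by simp
      moreover have "{i, f i} \<subseteq> U" using insert.prems by auto
      ultimately show ?thesis
        unfolding V_def using insert.prems(1)
        by (metis card_Diff_subset card_mono finite.emptyI finite_insert le_add_diff_inverse2)
    qed
    have "G \<subseteq> (\<lambda>(X, Y). X \<union> Y) ` ({{}, {i}, {f i}} \<times> F)"
    proof
      fix S assume S: "S \<in> G"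
      have "S - {i, f i} \<in> F" using S insert.hyps by (auto simp: G_def F_def V_def)
      moreover have "S \<inter> {i, f i} \<in> {{}, {i}, {f i}}" using S by (auto simp: G_def)
      moreover have "S = (S \<inter> {i, f i}) \<union> (S - {i, f i})" by blast
      ultimately show "S \<in> (\<lambda>(X, Y). X \<union> Y) ` ({{}, {i}, {f i}} \<times> F)"
        by (intro image_eqI[where x = "(S \<inter> {i, f i}, S - {i, f i})"] SigmaI) auto
    qed
    moreover have "finite F" using finV by (simp add: F_def)
    ultimately have "card G \<le> card ({{}, {i}, {f i}} \<times> F)"
      by (intro surj_card_le) simp_all
    also have "\<dots> = 3 * card F" using ne by (simp add: card_cartesian_product)
    finally have "card G \<le> 3 * card F" .
    then have "4 ^ card (insert i I) * card G \<le> 12 * (4 ^ card I * card F)"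
      using insert.hyps by simp
    also have "\<dots> \<le> 12 * (3 ^ card I * 2 ^ card V)" using IH by simp
    also have "\<dots> = 3 ^ card (insert i I) * 2 ^ card U"
      using insert.hyps by (simp add: cU power_add)
    finally show ?case by (simp add: G_def)
  qed
qed

text \<open>Since 3/4 is at most (7/8)^2, each pair pays for two units of the exponent. Thus pairs
  covering about half of an interval yield its whole length as exponent.\<close>

lemma card_avoiding_pairs_le_power:
  assumes "finite U" "I \<subseteq> U" "f ` I \<subseteq> U" "inj_on f I" "f ` I \<inter> I = {}" "x \<le> 2 * card I"
  shows "real (card {S \<in> Pow U. \<forall>i\<in>I. \<not> (i \<in> S \<and> f i \<in> S)}) \<le> (7/8) ^ x * 2 ^ card U"
proof -
  let ?c = "card {S \<in> Pow U. \<forall>i\<in>I. \<not> (i \<in> S \<and> f i \<in> S)}"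
  have "real (4 ^ card I * ?c) \<le> real (3 ^ card I * 2 ^ card U)"
    using card_avoiding_pairs_le[OF assms(1-5)] by (rule of_nat_mono)
  then have "real ?c \<le> (3/4) ^ card I * 2 ^ card U"
    by (simp add: power_divide field_simps)
  also have "(3/4::real) ^ card I \<le> ((7/8)^2) ^ card I"
    by (rule power_mono) (auto simp: power2_eq_square)
  also have "((7/8)^2) ^ card I = (7/8::real) ^ (2 * card I)" by (simp add: power_mult)
  also have "\<dots> \<le> (7/8) ^ x" using assms(6) by (intro power_decreasing) auto
  finally show ?thesis by simp
qed

lemma card_sum_missing_le:
  fixes n j :: int
  assumes "0 \<le> j" "j \<le> 2 * n"
  shows "real (card {S \<in> Pow {0..n}. j \<notin> S + S}) \<le> (7/8) ^ nat (min j (2 * n - j)) * 2 ^ nat (n + 1)"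
proof -
  \<comment> \<open>The smaller members \<open>i < j - i\<close> of the pairs in
    \<open>[0,n]\<close> with sum \<open>j\<close>; the upper bound leaves out the midpoint of an
    even \<open>j\<close>, which is not a proper pair.\<close>
  define I where "I = {max 0 (j - n)..<(j + 1) div 2}"
  have "card {S \<in> Pow {0..n}. j \<notin> S + S} \<le>
        card {S \<in> Pow {0..n}. \<forall>i\<in>I. \<not> (i \<in> S \<and> j - i \<in> S)}"
  proof (rule card_mono)
    show "{S \<in> Pow {0..n}. j \<notin> S + S} \<subseteq> {S \<in> Pow {0..n}. \<forall>i\<in>I. \<not> (i \<in> S \<and> j - i \<in> S)}"
      by (auto simp: set_plus_def) (metis add_diff_cancel_left' diff_add_cancel add.commute)
  qed simp
  also have "real \<dots> \<le> (7/8) ^ nat (min j (2 * n - j)) * 2 ^ card {0..n}"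
  proof (rule card_avoiding_pairs_le_power)
    show "nat (min j (2 * n - j)) \<le> 2 * card I" by (auto simp: I_def)
  qed (use assms in \<open>auto simp: I_def inj_on_def\<close>)
  finally show ?thesis by simp
qed

text \<open>In blocks of length \<open>2 * e\<close>, translation by \<open>- e\<close> injects the
  second halves into the first halves, even if \<open>m\<close> cuts the last block short.\<close>

lemma card_mod_less_ge:
  fixes e m :: int
  assumes "0 < e"
  shows "m \<le> 2 * int (card {i \<in> {0..<m}. i mod (2 * e) < e})"
proof -
  let ?I = "{i \<in> {0..<m}. i mod (2 * e) < e}"
  let ?J = "{i \<in> {0..<m}. \<not> i mod (2 * e) < e}"
  have "(\<lambda>i. i - e) ` ?J \<subseteq> ?I"
  proof clarsimp
    fix i assume i: "0 \<le> i" "i < m" "\<not> i mod (2 * e) < e"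
    have "i mod (2 * e) < 2 * e" using assms by simp
    then have "(i - e) mod (2 * e) = i mod (2 * e) - e"
      using i mult_div_mod_eq[of "2 * e" i]
      by (intro int_mod_pos_eq[of _ _ "i div (2 * e)"]) linarith+
    moreover have "e \<le> i" using i assms
      by (smt (verit) mod_pos_pos_trivial)
    ultimately show "e \<le> i \<and> i - e < m \<and> (i - e) mod (2 * e) < e"
      using assms i \<open>i mod (2 * e) < 2 * e\<close> by auto
  qed
  moreover have "finite ?I" by (rule finite_subset[of _ "{0..<m}"]) auto
  ultimately have "card ?J \<le> card ?I"
    by (intro card_inj_on_le[where f = "\<lambda>i. i - e"]) (auto simp: inj_on_def)
  moreover have "card ?I + card ?J = card {0..<m}"
  proof -
    have "?I \<union> ?J = {0..<m}" "?I \<inter> ?J = {}" by auto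
    then show ?thesis by (metis (no_types, lifting) card_Un_disjoint finite_Un finite_atLeastLessThan_int)
  qed
  ultimately show ?thesis by simp
qed

lemma card_diff_missing_le:
  fixes n e :: int
  assumes "0 \<le> e" "e \<le> n"
  shows "real (card {S \<in> Pow {0..n}. e \<notin> diffset S}) \<le> (7/8) ^ nat (n - e) * 2 ^ nat (n + 1)"
proof (cases "e = 0")
  \<comment> \<open>Here \<open>i\<close> and \<open>i + e\<close> coincide, so there are no pairs.
    But only the empty set lacks the difference 0, and the claimed bound is
    \<open>2 * (7/4) ^ nat n\<close>, which is at least 1.\<close>
  case True
  have "{S \<in> Pow {0..n}. e \<notin> diffset S} \<subseteq> {{}}" using True by (auto simp: diffset_def)
  then have "card {S \<in> Pow {0..n}. e \<notin> diffset S} \<le> 1"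
    by (metis card_mono finite.emptyI finite.insertI is_singletonI is_singleton_altdef)
  moreover have "1 \<le> (7/8) ^ nat n * (2::real) ^ nat (n + 1)"
  proof -
    have "1 \<le> (7/4::real) ^ nat n * 2"
    proof -
      have "1 \<le> (7/4::real) ^ nat n" by (rule one_le_power) simp
      then show ?thesis by linarith
    qed
    also have "\<dots> = (7/8) ^ nat n * 2 ^ nat (n + 1)"
      using assms by (simp add: nat_add_distrib power_mult_distrib[symmetric])
    finally show ?thesis .
  qed
  ultimately show ?thesis using True by simp
next
  case False
  then have e: "0 < e" using assms by simp
  \<comment> \<open>Over all \<open>i\<close> the pairs \<open>i\<close>, \<open>i + e\<close> would
    overlap in chains. Keeping \<open>i\<close> in the first half of its block of length
    \<open>2 * e\<close> puts \<open>i + e\<close> in the second half of that block, so the pairs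
    are disjoint, and at least half of the candidates survive.\<close>
  define I where "I = {i \<in> {0..<n - e + 1}. i mod (2 * e) < e}"
  have "card {S \<in> Pow {0..n}. e \<notin> diffset S} \<le>
        card {S \<in> Pow {0..n}. \<forall>i\<in>I. \<not> (i \<in> S \<and> i + e \<in> S)}"
  proof (rule card_mono)
    show "{S \<in> Pow {0..n}. e \<notin> diffset S} \<subseteq> {S \<in> Pow {0..n}. \<forall>i\<in>I. \<not> (i \<in> S \<and> i + e \<in> S)}"
      by (auto simp: diffset_def)
  qed simp
  also have "real \<dots> \<le> (7/8) ^ nat (n - e) * 2 ^ card {0..n}"
  proof (rule card_avoiding_pairs_le_power)
    show "nat (n - e) \<le> 2 * card I"
      using card_mod_less_ge[OF e, of "n - e + 1"] by (simp add: I_def)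
    have "(i + e) mod (2 * e) = i mod (2 * e) + e" if "i mod (2 * e) < e" for i
      using that e mult_div_mod_eq[of "2 * e" i] pos_mod_sign[of "2 * e" i]
      by (intro int_mod_pos_eq[of _ _ "i div (2 * e)"]) linarith+
    then show "(\<lambda>i. i + e) ` I \<inter> I = {}"
      using e by (auto simp: I_def) (smt (verit) pos_mod_sign)
  qed (use assms in \<open>auto simp: I_def inj_on_def\<close>)
  finally show ?thesis by simp
qed

text \<open>Nonnegative differences suffice because a difference set is symmetric. For
  \<open>a > n\<close> both ranges are empty.\<close>

definition fills :: "int \<Rightarrow> int \<Rightarrow> int set \<Rightarrow> bool" where
  "fills n a S \<longleftrightarrow> {a..2 * n - a} \<subseteq> S + S \<and> {0..n - a} \<subseteq> diffset S"

lemma fills_mono: "fills n a S \<Longrightarrow> S \<subseteq> T \<Longrightarrow> fills n a T"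
  unfolding fills_def
proof (elim conjE, intro conjI)
  assume "S \<subseteq> T"
  from this this have "S + S \<subseteq> T + T" and "diffset S \<subseteq> diffset T"
    by (rule set_plus_mono2) (use \<open>S \<subseteq> T\<close> in \<open>auto simp: diffset_def\<close>)
  then show "{a..2 * n - a} \<subseteq> S + S \<Longrightarrow> {a..2 * n - a} \<subseteq> T + T"
    and "{0..n - a} \<subseteq> diffset S \<Longrightarrow> {0..n - a} \<subseteq> diffset T" by auto
qed

text \<open>Injectivity makes the exponents distinct, so the geometric series from exponent
  \<open>a\<close> on dominates. The map \<open>g\<close> lets one bound serve \<open>j\<close>,
  \<open>2 * n - j\<close> and \<open>n - e\<close>.\<close>

lemma sum_geometric_tail_le:
  fixes g :: "int \<Rightarrow> int"
  assumes "finite J" "inj_on g J" "\<And>j. j \<in> J \<Longrightarrow> a \<le> g j" "0 \<le> a"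
  shows "(\<Sum>j\<in>J. (7/8::real) ^ nat (g j)) \<le> 8 * (7/8) ^ nat a"
proof -
  let ?h = "\<lambda>j. nat (g j - a)"
  have "nat (g j) = nat a + ?h j" if "j \<in> J" for j using assms(3)[OF that] assms(4) by simp
  then have "(\<Sum>j\<in>J. (7/8::real) ^ nat (g j)) = (7/8) ^ nat a * (\<Sum>j\<in>J. (7/8) ^ ?h j)"
    by (simp add: power_add sum_distrib_left cong: sum.cong)
  also have "(\<Sum>j\<in>J. (7/8::real) ^ ?h j) = (\<Sum>i\<in>?h ` J. (7/8) ^ i)"
  proof (rule sum.reindex_cong[symmetric, OF _ refl refl])
    show "inj_on ?h J" using assms(2,3) by (auto simp: inj_on_def) (smt (verit) nat_eq_iff)
  qed
  also have "\<dots> \<le> (\<Sum>i. (7/8) ^ i)"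
    by (rule sum_le_suminf) (use assms in \<open>auto intro: summable_geometric\<close>)
  also have "\<dots> = 8" by (subst suminf_geometric) auto
  finally show ?thesis by simp
qed

text \<open>Union bound over the missing sums and differences. The 24 is three geometric tails of 8:
  sums near 0, sums near \<open>2 * n\<close>, differences near \<open>n\<close>.\<close>

lemma card_not_fills_le:
  fixes n a :: int
  assumes "0 \<le> a"
  shows "real (card {S \<in> Pow {0..n}. \<not> fills n a S}) \<le> 24 * (7/8) ^ nat a * 2 ^ nat (n + 1)"
proof -
  define J E where "J = {a..2 * n - a}" and "E = {0..n - a}"
  define C D where "C j = {S \<in> Pow {0..n}. j \<notin> S + S}" and "D e = {S \<in> Pow {0..n}. e \<notin> diffset S}" for j e
  let ?P = "2 ^ nat (n + 1) :: real"
  have "{S \<in> Pow {0..n}. \<not> fills n a S} \<subseteq> (\<Union>j\<in>J. C j) \<union> (\<Union>e\<in>E. D e)"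
    by (auto simp: J_def E_def C_def D_def fills_def)
  then have "card {S \<in> Pow {0..n}. \<not> fills n a S} \<le> card ((\<Union>j\<in>J. C j) \<union> (\<Union>e\<in>E. D e))"
    by (rule card_mono[rotated]) (auto simp: J_def E_def C_def D_def)
  also have "\<dots> \<le> card (\<Union>j\<in>J. C j) + card (\<Union>e\<in>E. D e)" by (rule card_Un_le)
  also have "\<dots> \<le> (\<Sum>j\<in>J. card (C j)) + (\<Sum>e\<in>E. card (D e))"
    by (intro add_mono card_UN_le) (auto simp: J_def E_def)
  finally have "real (card {S \<in> Pow {0..n}. \<not> fills n a S})
      \<le> real ((\<Sum>j\<in>J. card (C j)) + (\<Sum>e\<in>E. card (D e)))"
    by (rule of_nat_mono)
  also have "\<dots> = (\<Sum>j\<in>J. real (card (C j))) + (\<Sum>e\<in>E. real (card (D e)))" by simp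
  also have "(\<Sum>j\<in>J. real (card (C j))) \<le> (\<Sum>j\<in>J. ((7/8) ^ nat j + (7/8) ^ nat (2 * n - j)) * ?P)"
  proof (rule sum_mono)
    fix j assume "j \<in> J"
    then have "real (card (C j)) \<le> (7/8) ^ nat (min j (2 * n - j)) * ?P"
      unfolding C_def using assms by (intro card_sum_missing_le) (auto simp: J_def)
    \<comment> \<open>Replacing the power at the minimum by both powers separates the two
      ends.\<close>
    also have "\<dots> \<le> ((7/8) ^ nat j + (7/8) ^ nat (2 * n - j)) * ?P"
      by (intro mult_right_mono) (auto simp: min_def)
    finally show "real (card (C j)) \<le> ((7/8) ^ nat j + (7/8) ^ nat (2 * n - j)) * ?P" .
  qed
  also have "\<dots> = ((\<Sum>j\<in>J. (7/8) ^ nat j) + (\<Sum>j\<in>J. (7/8) ^ nat (2 * n - j))) * ?P"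
    by (simp only: sum.distrib flip: sum_distrib_right)
  also have "\<dots> \<le> (8 * (7/8) ^ nat a + 8 * (7/8) ^ nat a) * ?P"
    using assms by (intro mult_right_mono add_mono sum_geometric_tail_le)
      (auto simp: J_def inj_on_def)
  also have "(\<Sum>e\<in>E. real (card (D e))) \<le> (\<Sum>e\<in>E. (7/8) ^ nat (n - e) * ?P)"
    unfolding D_def using assms by (intro sum_mono card_diff_missing_le) (auto simp: E_def)
  also have "\<dots> = (\<Sum>e\<in>E. (7/8) ^ nat (n - e)) * ?P" by (simp only: sum_distrib_right)
  also have "\<dots> \<le> 8 * (7/8) ^ nat a * ?P"
    using assms by (intro mult_right_mono sum_geometric_tail_le) (auto simp: E_def inj_on_def)
  finally show ?thesis by (simp add: algebra_simps)
qed

section \<open>Toggling an element of the middle\<close>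

lemma lambda_pair_insert:
  assumes "S \<subseteq> {0..int n}" "fills (int n) a S" "a \<le> k" "k \<le> int n - a" "0 \<le> a"
  shows "lambda_pair n (insert k S) = lambda_pair n S"
proof -
  \<comment> \<open>For \<open>x\<close> in \<open>[0,n]\<close> the sum \<open>k + x\<close> lies
    in \<open>[k, n + k]\<close>, inside \<open>[a, 2n - a]\<close>, and
    \<open>\<bar>k - x\<bar>\<close> is at most the larger of \<open>k\<close> and
    \<open>n - k\<close>, hence at most \<open>n - a\<close>. Whatever \<open>k\<close> could create
    is already there.\<close>
  have "k + x \<in> S + S" if "x \<in> insert k S" for x
    using that assms by (auto simp: fills_def subset_iff)
  then have "insert k S + insert k S \<subseteq> S + S"
    by (smt (verit, best) add.commute insert_iff set_plus_elim set_plus_intro subsetI)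
  then have "insert k S + insert k S = S + S"
    by (meson set_plus_mono2 subset_antisym subset_insertI)
  have abs: "\<bar>k - x\<bar> \<in> diffset S" if "x \<in> insert k S" for x
    using that assms by (auto simp: fills_def subset_iff)
  have neg: "- e \<in> diffset S" if "e \<in> diffset S" for e
    using that by (fastforce simp: diffset_def)
  have "k - x \<in> diffset S \<and> x - k \<in> diffset S" if "x \<in> insert k S" for x
    using abs[OF that] neg[OF abs[OF that]] by (auto simp: abs_if split: if_splits)
  then have "diffset (insert k S) = diffset S" unfolding diffset_def by blast
  with \<open>insert k S + insert k S = S + S\<close> show ?thesis by (simp add: lambda_pair_def)
qed

text \<open>Toggling \<open>k\<close> matches \<open>X\<close> with \<open>Y\<close> whenever the
  set without \<open>k\<close> is filled, so the exceptions in either direction are bounded by the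
  unfilled sets.\<close>

lemma card_lambda_pair_balance:
  fixes n :: nat and a k :: int and \<Lambda>
  assumes "a \<le> k" "k \<le> int n - a" "0 \<le> a"
  defines "X \<equiv> {S \<in> Pow {0..int n}. k \<in> S \<and> lambda_pair n S \<in> \<Lambda>}"
    and "Y \<equiv> {S \<in> Pow {0..int n}. k \<notin> S \<and> lambda_pair n S \<in> \<Lambda>}"
  shows "\<bar>real (card X) - real (card Y)\<bar> \<le> real (card {S \<in> Pow {0..int n}. \<not> fills (int n) a S})"
proof -
  let ?B = "{S \<in> Pow {0..int n}. \<not> fills (int n) a S}"
  have fin: "finite X" "finite Y" "finite ?B" by (auto simp: X_def Y_def)
  have k: "k \<in> {0..int n}" using assms by auto
  have "(\<lambda>S. S - {k}) ` X \<subseteq> Y \<union> ?B"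
  proof (rule subsetI)
    fix T assume "T \<in> (\<lambda>S. S - {k}) ` X"
    then have T: "k \<notin> T" "T \<subseteq> {0..int n}" "lambda_pair n (insert k T) \<in> \<Lambda>"
      by (auto simp: X_def insert_absorb)
    then show "T \<in> Y \<union> ?B"
      using lambda_pair_insert[of T n a k] assms(1-3) by (auto simp: Y_def)
  qed
  moreover have "inj_on (\<lambda>S. S - {k}) X" by (auto simp: inj_on_def X_def)
  ultimately have "card X \<le> card (Y \<union> ?B)" using fin by (meson card_inj_on_le finite_UnI)
  then have 1: "card X \<le> card Y + card ?B" using card_Un_le le_trans by blast
  \<comment> \<open>\<open>insert k S\<close> can be filled although \<open>S\<close> is not, so the
    exceptions are the image of \<open>?B\<close>, which is no larger than
    \<open>?B\<close>.\<close>
  have "insert k ` Y \<subseteq> X \<union> insert k ` ?B"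
  proof (rule subsetI)
    fix T assume "T \<in> insert k ` Y"
    then obtain S where S: "S \<in> Y" "T = insert k S" by auto
    show "T \<in> X \<union> insert k ` ?B"
    proof (cases "fills (int n) a S")
      case True
      then have "T \<in> X" using S k lambda_pair_insert[of S n a k] assms(1-3) by (simp add: X_def Y_def)
      then show ?thesis by simp
    qed (use S in \<open>auto simp: Y_def\<close>)
  qed
  moreover have "inj_on (insert k) Y" by (auto simp: inj_on_def Y_def)
  ultimately have "card Y \<le> card (X \<union> insert k ` ?B)" using fin
    by (meson card_inj_on_le finite_UnI finite_imageI)
  also have "\<dots> \<le> card X + card ?B"
    using card_Un_le[of X "insert k ` ?B"] card_image_le[OF fin(3), of "insert k"] by linarith
  finally show ?thesis using 1 by linarith
qed

subsection \<open>Fringes with prescribed numbers of missing sums and differences\<close>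

lemma card_compl_shift:
  fixes X :: "nat set"
  assumes "finite (- X)"
  shows "card (- (a +o X)) = a + card (- X)"
proof -
  have "- (a +o X) = {..<a} \<union> (+) a ` (- X)"
  proof (rule set_eqI)
    fix x show "x \<in> - (a +o X) \<longleftrightarrow> x \<in> {..<a} \<union> (+) a ` (- X)"
      by (cases "x < a") (auto simp: elt_set_plus_def image_iff not_less dest: le_Suc_ex)
  qed
  also have "card \<dots> = a + card (- X)"
    using assms by (subst card_Un_disjoint) (auto simp: card_image)
  finally show ?thesis .
qed

lemma compl_sumset_subset:
  fixes A B :: "nat set"
  assumes "{m..} \<subseteq> A" "{m..} \<subseteq> B"
  shows "- (A + B) \<subseteq> {..<2 * m}"
proof (rule subsetI, rule ccontr)
  fix x assume x: "x \<in> - (A + B)" "x \<notin> {..<2 * m}"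
  then have "m \<in> A" "x - m \<in> B" "x = m + (x - m)" using assms by auto
  then show False using x(1) by (metis ComplD set_plus_intro)
qed

text \<open>\<open>A\<close> describes the lower end of a subset of \<open>[0,n]\<close>, and \<open>B\<close> the upper end read backwards from
  \<open>n\<close>: a sum in \<open>A + B\<close> is the defect \<open>n - e\<close> of a difference \<open>e\<close>.\<close>

definition fringe_pair :: "nat \<Rightarrow> nat \<Rightarrow> nat set \<Rightarrow> nat set \<Rightarrow> bool" where
  "fringe_pair s t A B \<longleftrightarrow> (\<exists>m. {m..} \<subseteq> A \<and> {m..} \<subseteq> B)
     \<and> card (- (A + A)) + card (- (B + B)) = s \<and> card (- (A + B)) = t"

text \<open>The translate of \<open>A\<close> makes \<open>A + A\<close> miss \<open>2 * a\<close>
  further numbers and \<open>A + B\<close> miss \<open>a\<close>, while \<open>B + B\<close> stays.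
  So \<open>(s, t)\<close> can be moved along the direction (2, 1).\<close>

lemma fringe_pair_shift:
  assumes "fringe_pair s t A B"
  shows "fringe_pair (s + 2 * a) (t + a) (a +o A) B"
proof -
  obtain m where m: "{m..} \<subseteq> A" "{m..} \<subseteq> B" using assms by (auto simp: fringe_pair_def)
  have "{m + a..} \<subseteq> a +o A"
  proof
    fix x assume "x \<in> {m + a..}"
    then have "x - a \<in> A" "x = a + (x - a)" using m by auto
    then show "x \<in> a +o A" by (metis set_plus_intro2)
  qed
  moreover have "{m + a..} \<subseteq> B" using m by auto
  moreover have "finite (- (A + A))" "finite (- (A + B))"
    using compl_sumset_subset m finite_subset finite_lessThan by metis+
  moreover have "(a +o A) + (a +o A) = (a + a) +o (A + A)" "(a +o A) + B = a +o (A + B)"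
    by (rule set_plus_rearrange, rule set_plus_rearrange3)
  ultimately show ?thesis
    using assms by (auto simp: fringe_pair_def card_compl_shift)
qed

text \<open>The cutoff \<open>8 * t\<close> is chosen because a residue class modulo 8 has exactly
  \<open>t\<close> members below it: a sumset that omits one class there misses \<open>t\<close>
  numbers.\<close>

definition truncated_periodic :: "nat set \<Rightarrow> nat \<Rightarrow> nat set" where
  "truncated_periodic P t = {x. x mod 8 \<in> P \<or> 8 * t \<le> x}"

text \<open>The residue is reached without a carry, \<open>r = p + q\<close>, so even the smallest
  \<open>x\<close> of the class is covered by adding the multiple of 8 to \<open>p\<close>.\<close>

lemma sumset_covers:
  assumes "r \<in> P + Q" "r < 8" "x mod 8 = r" "P \<subseteq> {..<8}" "Q \<subseteq> {..<8}"
  shows "x \<in> truncated_periodic P t + truncated_periodic Q t"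
proof -
  obtain p q where pq: "p \<in> P" "q \<in> Q" "r = p + q" using assms by (auto simp: set_plus_def)
  have "x = (p + 8 * (x div 8)) + q" using assms pq by presburger
  moreover have "p + 8 * (x div 8) \<in> truncated_periodic P t"
    using pq assms by (auto simp: truncated_periodic_def)
  moreover have "q \<in> truncated_periodic Q t" using pq assms by (auto simp: truncated_periodic_def)
  ultimately show ?thesis by (metis set_plus_intro)
qed

lemma card_residue_class:
  fixes c t :: nat assumes "c < 8"
  shows "card {x. x mod 8 = c \<and> x < 8 * t} = t"
proof -
  have "{x. x mod 8 = c \<and> x < 8 * t} = (\<lambda>q. 8 * q + c) ` {..<t}"
  proof (rule set_eqI)
    fix x
    have "x = 8 * (x div 8) + c" if "x mod 8 = c" using that by presburger
    moreover have "x div 8 < t" if "x < 8 * t" using that by (simp add: less_mult_imp_div_less mult.commute)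
    ultimately show "x \<in> {x. x mod 8 = c \<and> x < 8 * t} \<longleftrightarrow> x \<in> (\<lambda>q. 8 * q + c) ` {..<t}"
      using assms by auto
  qed
  also have "card \<dots> = t" by (subst card_image) (auto simp: inj_on_def)
  finally show ?thesis .
qed

text \<open>Below the cutoff both summands are governed by their residues, so the class of
  \<open>c\<close> is never hit; from the cutoff on, \<open>0 + x\<close> hits everything.\<close>

lemma sumset_misses_residue:
  assumes "c < 8" "0 \<in> P" "P \<subseteq> {..<8}" "Q \<subseteq> {..<8}"
    and cov: "{..<8} - {c} \<subseteq> P + Q"
    and mis: "\<And>p q. p \<in> P \<Longrightarrow> q \<in> Q \<Longrightarrow> (p + q) mod 8 \<noteq> c"
  shows "card (- (truncated_periodic P t + truncated_periodic Q t)) = t"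
proof -
  let ?A = "truncated_periodic P t" and ?B = "truncated_periodic Q t"
  have "- (?A + ?B) = {x. x mod 8 = c \<and> x < 8 * t}"
  proof (intro set_eqI iffI)
    fix x assume x: "x \<in> - (?A + ?B)"
    have "x mod 8 = c"
    proof (rule ccontr)
      assume "x mod 8 \<noteq> c"
      then have "x mod 8 \<in> P + Q" using cov by auto
      then show False using x sumset_covers[of "x mod 8" P Q x] assms by auto
    qed
    moreover have "x < 8 * t"
    proof (rule ccontr)
      assume "\<not> x < 8 * t"
      then have "x \<in> ?B" "0 \<in> ?A" using assms by (auto simp: truncated_periodic_def)
      then have "0 + x \<in> ?A + ?B" by (rule set_plus_intro[rotated])
      then show False using x by simp
    qed
    ultimately show "x \<in> {x. x mod 8 = c \<and> x < 8 * t}" by simp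
  next
    fix x assume x: "x \<in> {x. x mod 8 = c \<and> x < 8 * t}"
    show "x \<in> - (?A + ?B)"
    proof
      assume "x \<in> ?A + ?B"
      then obtain a b where ab: "a \<in> ?A" "b \<in> ?B" "x = a + b" by (auto simp: set_plus_def)
      then have "a mod 8 \<in> P" "b mod 8 \<in> Q" using x by (auto simp: truncated_periodic_def)
      then have "(a mod 8 + b mod 8) mod 8 \<noteq> c" by (rule mis)
      then show False using x ab by (simp add: mod_add_eq)
    qed
  qed
  then show ?thesis using card_residue_class[OF assms(1)] by simp
qed

lemma sumset_full:
  assumes "P \<subseteq> {..<8}" "Q \<subseteq> {..<8}" "{..<8} \<subseteq> P + Q"
  shows "truncated_periodic P t + truncated_periodic Q t = UNIV"
proof -
  have "x \<in> truncated_periodic P t + truncated_periodic Q t" for x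
    by (rule sumset_covers[OF _ _ refl]) (use assms in auto)
  then show ?thesis by blast
qed

lemma lessThan_8: "{..<8::nat} = {0,1,2,3,4,5,6,7}" by auto

text \<open>The residue sets modulo 8 in the next two lemmas were found by computer search.\<close>

lemma fringe_pair_0: "fringe_pair 0 t (truncated_periodic {0,1,3,4} t) (truncated_periodic {0,1,2,5} t)"
proof -
  have "truncated_periodic {0,1,3,4} t + truncated_periodic {0,1,3,4} t = UNIV"
    by (rule sumset_full) (auto simp: set_plus_def lessThan_8)
  moreover have "truncated_periodic {0,1,2,5} t + truncated_periodic {0,1,2,5} t = UNIV"
    by (rule sumset_full) (auto simp: set_plus_def lessThan_8)
  moreover have "card (- (truncated_periodic {0,1,3,4} t + truncated_periodic {0,1,2,5} t)) = t"
    by (rule sumset_misses_residue[where c = 7]) (auto simp: set_plus_def lessThan_8)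
  moreover have "{8 * t..} \<subseteq> truncated_periodic P t" for P by (auto simp: truncated_periodic_def)
  ultimately show ?thesis unfolding fringe_pair_def by (auto intro!: exI[of _ "8 * t"])
qed

lemma fringe_pair_1:
  assumes "0 < t"
  shows "fringe_pair 1 t (truncated_periodic {0,2,3,7} t) (truncated_periodic {0,1,2,5} t)"
proof -
  let ?A = "truncated_periodic {0,2,3,7} t"
  \<comment> \<open>Modulo 8, only 2 + 7 gives residue 1, and it carries to 9. So 1 itself is
    missed, while each larger \<open>x\<close> of the class is \<open>(x - 2) + 2\<close> with
    \<open>x - 2\<close> congruent to 7.\<close>
  have "- (?A + ?A) = {1}"
  proof (intro set_eqI iffI)
    fix x assume x: "x \<in> - (?A + ?A)"
    show "x \<in> {1}"
    proof (rule ccontr)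
      assume ne: "x \<notin> {1}"
      have "x mod 8 = 1"
      proof (rule ccontr)
        assume "x mod 8 \<noteq> 1"
        then have "x mod 8 \<in> {..<8} - {1}" by auto
        then have "x mod 8 \<in> {0,2,3,7} + {0,2,3,7}"
          unfolding lessThan_8 by (auto simp: set_plus_def)
        then show False using x sumset_covers[of "x mod 8" "{0,2,3,7}" "{0,2,3,7}" x] by auto
      qed
      moreover from this ne have "2 \<le> x" by (cases "x = 0") auto
      ultimately obtain y where y: "x = y + 2" "(y + 2) mod 8 = 1" by (metis le_add_diff_inverse2)
      then have "y mod 8 = 7" by presburger
      then have "y \<in> ?A" "2 \<in> ?A" by (auto simp: truncated_periodic_def)
      then have "y + 2 \<in> ?A + ?A" by (rule set_plus_intro)
      then show False using x y by blast
    qed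
  next
    \<comment> \<open>As \<open>0 < t\<close>, the number 1 lies below the cutoff and hence outside
      \<open>?A\<close>, which rules out 0 + 1.\<close>
    fix x :: nat assume "x \<in> {1}"
    then show "x \<in> - (?A + ?A)"
      using assms by (auto simp: truncated_periodic_def add_is_1 elim!: set_plus_elim dest!: sym[of "Suc 0"])
  qed
  moreover have "truncated_periodic {0,1,2,5} t + truncated_periodic {0,1,2,5} t = UNIV"
    by (rule sumset_full) (auto simp: set_plus_def lessThan_8)
  moreover have "card (- (?A + truncated_periodic {0,1,2,5} t)) = t"
    by (rule sumset_misses_residue[where c = 6]) (auto simp: set_plus_def lessThan_8)
  moreover have "{8 * t..} \<subseteq> truncated_periodic P t" for P by (auto simp: truncated_periodic_def)
  ultimately show ?thesis unfolding fringe_pair_def by (auto intro!: exI[of _ "8 * t"])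
qed

text \<open>The first set is a numerical semigroup with gaps \<open>1..s\<close>, so doubling it
  fills no gap, whereas adding \<open>UNIV\<close> fills them all.\<close>

lemma fringe_pair_no_diff: "fringe_pair s 0 (insert 0 {s + 1..}) UNIV"
proof -
  have "insert 0 {s + 1..} + insert 0 {s + 1..} = insert 0 {s + 1..}"
    by (auto simp: set_plus_def)
  moreover have "insert 0 {s + 1..} + UNIV = UNIV" "UNIV + UNIV = (UNIV :: nat set)"
    by (auto simp: set_plus_def) (metis add_0)+
  moreover have "- insert 0 {s + 1..} = {1..s}" by auto
  ultimately show ?thesis unfolding fringe_pair_def by (auto intro!: exI[of _ "s + 1"])
qed

lemma fringe_pair_exists: "\<exists>A B. fringe_pair s t A B"
proof -
  \<comment> \<open>The largest shift that keeps both entries nonnegative. It leaves either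
    \<open>t = 0\<close>, or \<open>s\<close> in {0, 1} with \<open>t\<close> positive.\<close>
  define a where "a = min t (s div 2)"
  have "\<exists>A B. fringe_pair (s - 2 * a) (t - a) A B"
  proof (cases "t \<le> s div 2")
    case True
    then show ?thesis using fringe_pair_no_diff by (auto simp: a_def)
  next
    case False
    then have "0 < t - a" "s - 2 * a = 0 \<or> s - 2 * a = 1" by (auto simp: a_def min_def)
    then show ?thesis using fringe_pair_0 fringe_pair_1 by metis
  qed
  moreover have "s - 2 * a + 2 * a = s" "t - a + a = t" by (auto simp: a_def min_def)
  ultimately show ?thesis using fringe_pair_shift by metis
qed

subsection \<open>Prescribing the fringes of a random set\<close>

text \<open>All summands are nonnegative, so those of a sum below \<open>M\<close> are themselves
  below \<open>M\<close>.\<close>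

lemma sumset_initial_segment:
  assumes "U \<subseteq> {0..}" "V \<subseteq> {0..}"
    and "\<And>i. i < M \<Longrightarrow> int i \<in> U \<longleftrightarrow> i \<in> A" "\<And>i. i < M \<Longrightarrow> int i \<in> V \<longleftrightarrow> i \<in> B"
    and "i < M"
  shows "int i \<in> U + V \<longleftrightarrow> i \<in> A + B"
proof
  assume "int i \<in> U + V"
  then obtain x y where "int i = x + y" "x \<in> U" "y \<in> V" by (rule set_plus_elim)
  moreover from this have "0 \<le> x" "0 \<le> y" using assms(1,2) by auto
  moreover from calculation have "i = nat x + nat y" by linarith
  moreover from calculation have "nat x \<in> A" "nat y \<in> B"
    using assms(3)[of "nat x"] assms(4)[of "nat y"] assms(5) by auto
  ultimately show "i \<in> A + B" by blast
next
  assume "i \<in> A + B"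
  then obtain x y where "i = x + y" "x \<in> A" "y \<in> B" by (rule set_plus_elim)
  then have "int i = int x + int y" "int x \<in> U" "int y \<in> V" using assms(3-5) by auto
  then show "int i \<in> U + V" by (metis set_plus_intro)
qed

text \<open>The filled middle confines missing sums to within \<open>M\<close> of 0 or
  \<open>2n\<close>, where \<open>A + A\<close> and \<open>B + B\<close> decide, and missing
  differences to absolute values above \<open>n - M\<close>, where \<open>A + B\<close> decides.
  Each number missed by \<open>A + B\<close> costs a difference and its negative, hence the factor
  2.\<close>

lemma lambda_pair_fringes:
  fixes n M :: nat
  assumes S: "S \<subseteq> {0..int n}" and "M \<le> n"
    and low: "\<And>i. i < M \<Longrightarrow> int i \<in> S \<longleftrightarrow> i \<in> A"
    and high: "\<And>i. i < M \<Longrightarrow> int n - int i \<in> S \<longleftrightarrow> i \<in> B"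
    and fills: "fills (int n) (int M) S"
    and AA: "- (A + A) \<subseteq> {..<M}" and BB: "- (B + B) \<subseteq> {..<M}" and AB: "- (A + B) \<subseteq> {..<M}"
  shows "lambda_pair n S
    = (int (card (- (A + A)) + card (- (B + B))), 2 * int (card (- (A + B))))"
proof -
  \<comment> \<open>Reading \<open>S\<close> backwards turns sums near \<open>2n\<close> into sums
    near 0, and a difference \<open>x - y\<close> into the sum \<open>y + (n - x)\<close>.\<close>
  define R where "R = (\<lambda>x. int n - x) ` S"
  have R: "R \<subseteq> {0..}" and S0: "S \<subseteq> {0..}" using S by (auto simp: R_def)
  have Rlow: "int i \<in> R \<longleftrightarrow> i \<in> B" if "i < M" for i
    using high[OF that] by (force simp: R_def)
  have low_sum: "int i \<in> S + S \<longleftrightarrow> i \<in> A + A" if "i < M" for i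
    by (rule sumset_initial_segment[OF S0 S0 low low that])
  have high_sum: "2 * int n - int i \<in> S + S \<longleftrightarrow> i \<in> B + B" if "i < M" for i
  proof -
    have "2 * int n - int i \<in> S + S \<longleftrightarrow> int i \<in> R + R"
    proof
      assume "2 * int n - int i \<in> S + S"
      then obtain x y where "2 * int n - int i = x + y" "x \<in> S" "y \<in> S" by (rule set_plus_elim)
      then have "int i = (int n - x) + (int n - y)" "int n - x \<in> R" "int n - y \<in> R"
        by (auto simp: R_def)
      then show "int i \<in> R + R" by (metis set_plus_intro)
    next
      assume "int i \<in> R + R"
      then obtain x y where "int i = (int n - x) + (int n - y)" "x \<in> S" "y \<in> S"
        by (auto simp: R_def elim!: set_plus_elim)
      then have "2 * int n - int i = x + y" "x \<in> S" "y \<in> S" by auto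
      then show "2 * int n - int i \<in> S + S" by (metis set_plus_intro)
    qed
    also have "\<dots> \<longleftrightarrow> i \<in> B + B" by (rule sumset_initial_segment[OF R R Rlow Rlow that])
    finally show ?thesis .
  qed
  have diff: "int n - int i \<in> diffset S \<longleftrightarrow> i \<in> A + B" if "i < M" for i
  proof -
    have "int n - int i \<in> diffset S \<longleftrightarrow> int i \<in> S + R"
    proof
      assume "int n - int i \<in> diffset S"
      then obtain x y where "int n - int i = x - y" "x \<in> S" "y \<in> S" by (auto simp: diffset_def)
      then have "int i = y + (int n - x)" "y \<in> S" "int n - x \<in> R" by (auto simp: R_def)
      then show "int i \<in> S + R" by (metis set_plus_intro)
    next
      assume "int i \<in> S + R"
      then obtain x y where "int i = x + (int n - y)" "x \<in> S" "y \<in> S"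
        by (auto simp: R_def elim!: set_plus_elim)
      then have "int n - int i = y - x" "x \<in> S" "y \<in> S" by auto
      then show "int n - int i \<in> diffset S" by (auto simp: diffset_def)
    qed
    also have "\<dots> \<longleftrightarrow> i \<in> A + B" by (rule sumset_initial_segment[OF S0 R low Rlow that])
    finally show ?thesis .
  qed
  have neg: "- e \<in> diffset S \<longleftrightarrow> e \<in> diffset S" for e
    by (rule iffI) (force simp: diffset_def)+
  have fin: "finite (- (A + A))" "finite (- (B + B))" "finite (- (A + B))"
    using AA BB AB finite_subset by blast+

  let ?mS = "{0..2 * int n} - (S + S)"
  have "?mS = int ` (- (A + A)) \<union> (\<lambda>i. 2 * int n - int i) ` (- (B + B))"
  proof (intro subset_antisym subsetI)
    fix j assume j: "j \<in> ?mS"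
    then have "j \<notin> {int M..2 * int n - int M}" using fills by (auto simp: fills_def)
    then consider "j < int M" | "2 * int n - j < int M" by force
    then show "j \<in> int ` (- (A + A)) \<union> (\<lambda>i. 2 * int n - int i) ` (- (B + B))"
    proof cases
      case 1
      then have "j = int (nat j)" "nat j < M" using j by auto
      moreover from this have "nat j \<in> - (A + A)" using j low_sum[of "nat j"] by auto
      ultimately show ?thesis by blast
    next
      case 2
      then have "j = 2 * int n - int (nat (2 * int n - j))" "nat (2 * int n - j) < M" using j by auto
      moreover from this have "nat (2 * int n - j) \<in> - (B + B)"
        using j high_sum[of "nat (2 * int n - j)"] by auto
      ultimately show ?thesis by blast
    qed
  next
    fix j assume "j \<in> int ` (- (A + A)) \<union> (\<lambda>i. 2 * int n - int i) ` (- (B + B))"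
    then consider i where "i \<notin> A + A" "j = int i" | i where "i \<notin> B + B" "j = 2 * int n - int i"
      by auto
    then show "j \<in> ?mS"
    proof cases
      case (1 i)
      then have "i < M" using AA by auto
      then show ?thesis using 1 low_sum \<open>M \<le> n\<close> by auto
    next
      case (2 i)
      then have "i < M" using BB by auto
      then show ?thesis using 2 high_sum \<open>M \<le> n\<close> by auto
    qed
  qed
  moreover have "int ` (- (A + A)) \<inter> (\<lambda>i. 2 * int n - int i) ` (- (B + B)) = {}"
  proof -
    \<comment> \<open>\<open>i + j < 2 * M\<close>, so \<open>M \<le> n\<close> keeps the two ends
      apart.\<close>
    have "int i \<noteq> 2 * int n - int j" if "i \<notin> A + A" "j \<notin> B + B" for i j
    proof -
      have "i < M" "j < M" using that AA BB by auto
      then show ?thesis using \<open>M \<le> n\<close> by linarith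
    qed
    then show ?thesis by blast
  qed
  ultimately have mS: "card ?mS = card (- (A + A)) + card (- (B + B))"
    using fin by (simp add: card_Un_disjoint card_image inj_on_def)

  let ?mD = "{- int n..int n} - diffset S"
  have "?mD = (\<lambda>i. int n - int i) ` (- (A + B)) \<union> (\<lambda>i. int i - int n) ` (- (A + B))"
  proof (intro subset_antisym subsetI)
    fix e assume e: "e \<in> ?mD"
    then have "\<bar>e\<bar> \<notin> diffset S" using neg[of e] by (auto simp: abs_if)
    then have "\<bar>e\<bar> \<notin> {0..int n - int M}" using fills unfolding fills_def by blast
    define i where "i = nat (int n - \<bar>e\<bar>)"
    have i: "i < M" "\<bar>e\<bar> = int n - int i" using e \<open>\<bar>e\<bar> \<notin> {0..int n - int M}\<close> by (auto simp: i_def)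
    then have "i \<in> - (A + B)" using diff[of i] \<open>\<bar>e\<bar> \<notin> diffset S\<close> by auto
    moreover have "e = int n - int i \<or> e = int i - int n" using i by linarith
    ultimately show "e \<in> (\<lambda>i. int n - int i) ` (- (A + B)) \<union> (\<lambda>i. int i - int n) ` (- (A + B))"
      by blast
  next
    fix e assume "e \<in> (\<lambda>i. int n - int i) ` (- (A + B)) \<union> (\<lambda>i. int i - int n) ` (- (A + B))"
    then obtain i where i: "i \<notin> A + B" "e = int n - int i \<or> e = - (int n - int i)" by auto
    then have "i < M" using AB by auto
    then show "e \<in> ?mD" using i diff neg[of "int n - int i"] \<open>M \<le> n\<close> by auto
  qed
  moreover have "(\<lambda>i. int n - int i) ` (- (A + B)) \<inter> (\<lambda>i. int i - int n) ` (- (A + B)) = {}"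
  proof -
    have "int n - int i \<noteq> int j - int n" if "i \<notin> A + B" "j \<notin> A + B" for i j
    proof -
      have "i < M" "j < M" using that AB by auto
      then show ?thesis using \<open>M \<le> n\<close> by linarith
    qed
    then show ?thesis by blast
  qed
  ultimately have mD: "card ?mD = 2 * card (- (A + B))"
    using fin by (simp add: card_Un_disjoint card_image inj_on_def)

  have "S + S \<subseteq> {0..2 * int n}"
    by (auto elim!: set_plus_elim dest!: subsetD[OF S])
  then have "int (card ?mS) = 2 * int n + 1 - int (card (S + S))"
    using card_mono[of "{0..2 * int n}" "S + S"] by (simp add: card_Diff_subset finite_subset of_nat_diff)
  moreover have "diffset S \<subseteq> {- int n..int n}"
    by (auto simp: diffset_def dest!: subsetD[OF S])
  then have "int (card ?mD) = 2 * int n + 1 - int (card (diffset S))"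
    using card_mono[of "{- int n..int n}" "diffset S"]
    by (simp add: card_Diff_subset finite_subset of_nat_diff)
  ultimately show ?thesis using mS mD by (simp add: lambda_pair_def)
qed

text \<open>Translation by \<open>m\<close> moves sums by \<open>2 * m\<close> and fixes
  differences, while the ambient interval gains \<open>m\<close> places at each end; with
  \<open>a\<close> raised by \<open>2 * m\<close> both ranges match exactly.\<close>

lemma fills_shift:
  assumes "fills N a T"
  shows "fills (N + 2 * m) (a + 2 * m) ((+) m ` T)"
  unfolding fills_def
proof (intro conjI subsetI)
  fix j assume "j \<in> {a + 2 * m..2 * (N + 2 * m) - (a + 2 * m)}"
  then have "j - 2 * m \<in> {a..2 * N - a}" by auto
  then have "j - 2 * m \<in> T + T" using assms by (auto simp: fills_def)
  then obtain x y where "j - 2 * m = x + y" "x \<in> T" "y \<in> T" by (rule set_plus_elim)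
  then have "j = (m + x) + (m + y)" "m + x \<in> (+) m ` T" "m + y \<in> (+) m ` T" by auto
  then show "j \<in> (+) m ` T + (+) m ` T" by (metis set_plus_intro)
next
  fix e assume "e \<in> {0..N + 2 * m - (a + 2 * m)}"
  then have "e \<in> diffset T" using assms by (auto simp: fills_def)
  then obtain x y where "e = x - y" "x \<in> T" "y \<in> T" by (auto simp: diffset_def)
  then have "e = (m + x) - (m + y)" "m + x \<in> (+) m ` T" "m + y \<in> (+) m ` T" by auto
  then show "e \<in> diffset ((+) m ` T)" unfolding diffset_def by blast
qed

text \<open>The sets counted here are obtained from a filled \<open>T \<subseteq> [0, n - 2m]\<close> by translating it by \<open>m\<close> and
  overwriting both ends of length \<open>M\<close>. Since \<open>A\<close> and \<open>B\<close> contain everything from \<open>m\<close> on, overwriting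
  loses no element of the translate, so the result is still filled.\<close>

lemma card_lambda_pair_eq_ge:
  assumes "fringe_pair s t A B"
  shows "\<exists>\<delta>>0. \<forall>\<^sub>F n in sequentially.
    \<delta> * 2 ^ (n + 1) \<le> real (card {S \<in> Pow {0..int n}. lambda_pair n S = (int s, 2 * int t)})"
proof -
  obtain m where m: "{m..} \<subseteq> A" "{m..} \<subseteq> B" using assms by (auto simp: fringe_pair_def)
  \<comment> \<open>With this \<open>a\<close> at least half of all sets are filled.\<close>
  obtain a :: nat where "(7/8::real) ^ a < 1/48" using real_arch_pow_inv[of "1/48" "7/8"] by auto
  then have a: "24 * (7/8::real) ^ a \<le> 1/2" by simp
  \<comment> \<open>The width given by \<open>fills_shift\<close>; it also exceeds every number
    missed by \<open>A + A\<close>, \<open>B + B\<close> or \<open>A + B\<close>, all of which lie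
    below \<open>2 * m\<close>.\<close>
  define M where "M = a + 2 * m"
  \<comment> \<open>The exponent collects \<open>2 * m\<close> for the shorter interval,
    \<open>2 * (m + a)\<close> for the overwritten positions and 1 for restricting to filled
    sets.\<close>
  define \<delta> :: real where "\<delta> = 1 / 2 ^ (4 * m + 2 * a + 1)"
  have "\<delta> * 2 ^ (n + 1) \<le> real (card {S \<in> Pow {0..int n}. lambda_pair n S = (int s, 2 * int t)})"
    if n: "2 * M \<le> n" for n
  proof -
    define L where "L = {S \<in> Pow {0..int n}. lambda_pair n S = (int s, 2 * int t)}"
    define N where "N = int n - 2 * int m"
    define G where "G = {T \<in> Pow {0..N}. fills N (int a) T}"
    \<comment> \<open>The positions of \<open>T\<close> that land in the overwritten ends after
      translation by \<open>m\<close>.\<close>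
    define C where "C = {0..<int (m + a)} \<union> {N - int (m + a)<..N}"
    define F where "F = int ` (A \<inter> {..<M}) \<union> (\<lambda>i. int n - int i) ` (B \<inter> {..<M})"
    define \<Phi> where "\<Phi> T = F \<union> ((+) (int m) ` T \<inter> {int M..int n - int M})" for T
    have L: "\<Phi> T \<in> L" if T: "T \<in> G" for T
    proof -
      have sub: "\<Phi> T \<subseteq> {0..int n}" using n by (auto simp: \<Phi>_def F_def)
      have "(+) (int m) ` T \<subseteq> \<Phi> T"
      proof
        fix y assume y: "y \<in> (+) (int m) ` T"
        then have "int m \<le> y" "y \<le> int n - int m" using T by (auto simp: G_def N_def)
        then have A: "nat y \<in> A" and B: "nat (int n - y) \<in> B" using m by auto
        consider "y < int M" | "int n - y < int M" | "y \<in> {int M..int n - int M}" by force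
        then show "y \<in> \<Phi> T"
        proof cases
          case 1
          then have "y = int (nat y)" "nat y \<in> A \<inter> {..<M}" using A \<open>int m \<le> y\<close> by auto
          then show ?thesis unfolding \<Phi>_def F_def by blast
        next
          case 2
          then have "y = int n - int (nat (int n - y))" "nat (int n - y) \<in> B \<inter> {..<M}"
            using B \<open>y \<le> int n - int m\<close> by auto
          then show ?thesis unfolding \<Phi>_def F_def by blast
        qed (use y in \<open>auto simp: \<Phi>_def\<close>)
      qed
      moreover have "fills (int n) (int M) ((+) (int m) ` T)"
        using fills_shift[of N "int a" T "int m"] T by (simp add: G_def N_def M_def)
      ultimately have fl: "fills (int n) (int M) (\<Phi> T)" using fills_mono by blast
      have low: "int i \<in> \<Phi> T \<longleftrightarrow> i \<in> A" if "i < M" for i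
        using that n by (auto simp: \<Phi>_def F_def)
      have high: "int n - int i \<in> \<Phi> T \<longleftrightarrow> i \<in> B" if "i < M" for i
        using that n by (auto simp: \<Phi>_def F_def)
      have sub_M: "- (A + A) \<subseteq> {..<M}" "- (B + B) \<subseteq> {..<M}" "- (A + B) \<subseteq> {..<M}"
        using compl_sumset_subset[OF m(1) m(1)] compl_sumset_subset[OF m(2) m(2)]
          compl_sumset_subset[OF m] by (fastforce simp: M_def)+
      show ?thesis
        using lambda_pair_fringes[OF sub _ low high fl sub_M] assms n sub
        by (simp add: L_def fringe_pair_def)
    qed
    \<comment> \<open>\<open>\<Phi>\<close> may forget \<open>T\<close> only on \<open>C\<close>, so
      each of its fibres has at most \<open>2 ^ card C\<close> elements.\<close>
    have "inj_on (\<lambda>T. (\<Phi> T, T \<inter> C)) G"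
    proof (rule inj_onI)
      fix T T' assume T: "T \<in> G" "T' \<in> G" and eq: "(\<Phi> T, T \<inter> C) = (\<Phi> T', T' \<inter> C)"
      have middle: "x \<in> U \<longleftrightarrow> int m + x \<in> \<Phi> U" if "x \<in> {0..N}" "x \<notin> C" for x U
      proof -
        have "int m + x \<in> {int M..int n - int M}" using that by (auto simp: C_def N_def M_def)
        then show ?thesis by (auto simp: \<Phi>_def F_def)
      qed
      show "T = T'"
      proof (rule set_eqI)
        fix x show "x \<in> T \<longleftrightarrow> x \<in> T'"
        proof (cases "x \<in> {0..N} - C")
          case True
          then show ?thesis using middle eq by auto
        next
          case False
          then show ?thesis using T eq by (auto simp: G_def)
        qed
      qed
    qed
    moreover have "(\<lambda>T. (\<Phi> T, T \<inter> C)) ` G \<subseteq> L \<times> Pow C" using L by auto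
    moreover have "finite (L \<times> Pow C)" by (simp add: L_def C_def)
    ultimately have "card G \<le> card (L \<times> Pow C)" by (rule card_inj_on_le)
    also have "\<dots> = card L * 2 ^ card C" by (simp add: card_cartesian_product card_Pow C_def)
    also have "\<dots> \<le> card L * 2 ^ (2 * (m + a))"
      using card_Un_le[of "{0..<int (m + a)}" "{N - int (m + a)<..N}"]
      by (intro mult_left_mono power_increasing) (auto simp: C_def)
    finally have "real (card G) \<le> real (card L * 2 ^ (2 * (m + a)))" by (rule of_nat_mono)
    then have GL: "real (card G) \<le> real (card L) * 2 ^ (2 * (m + a))" by simp
    have cardN: "nat (N + 1) = n + 1 - 2 * m" using n by (simp add: N_def M_def)
    have "card G + card {T \<in> Pow {0..N}. \<not> fills N (int a) T} = card (Pow {0..N})"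
    proof -
      have "card (Pow {0..N}) = card (G \<union> {T \<in> Pow {0..N}. \<not> fills N (int a) T})"
        by (rule arg_cong[where f = card]) (auto simp: G_def)
      also have "\<dots> = card G + card {T \<in> Pow {0..N}. \<not> fills N (int a) T}"
        by (rule card_Un_disjoint) (auto simp: G_def)
      finally show ?thesis by simp
    qed
    then have "real (card G) + real (card {T \<in> Pow {0..N}. \<not> fills N (int a) T}) = 2 ^ (n + 1 - 2 * m)"
      by (simp add: card_Pow cardN flip: of_nat_add)
    moreover have "real (card {T \<in> Pow {0..N}. \<not> fills N (int a) T}) \<le> 1/2 * 2 ^ (n + 1 - 2 * m)"
    proof -
      have "real (card {T \<in> Pow {0..N}. \<not> fills N (int a) T})
          \<le> 24 * (7/8) ^ a * 2 ^ (n + 1 - 2 * m)"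
        using card_not_fills_le[of "int a" N] by (simp add: cardN)
      also have "\<dots> \<le> 1/2 * 2 ^ (n + 1 - 2 * m)" by (rule mult_right_mono[OF a]) simp
      finally show ?thesis .
    qed
    ultimately have "2 ^ (n + 1 - 2 * m) / 2 \<le> real (card L) * 2 ^ (2 * (m + a))" using GL by linarith
    moreover have "(2::real) ^ (n + 1) = 2 ^ (n + 1 - 2 * m) * 2 ^ (2 * m)"
      using n by (simp add: M_def flip: power_add)
    moreover have "(2::real) ^ (4 * m + 2 * a + 1) = 2 ^ (2 * m) * 2 ^ (2 * (m + a)) * 2"
      by (simp flip: power_add)
    ultimately show ?thesis by (simp add: \<delta>_def L_def field_simps)
  qed
  moreover have "\<delta> > 0" by (simp add: \<delta>_def)
  ultimately show ?thesis using eventually_sequentially by blast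
qed

section \<open>The conditional probability and its limit\<close>

lemma cond_prob_random_subset:
  "\<P>(S in measure_pmf (random_subset n). P S \<bar> Q S) =
    real (card {S \<in> Pow {0..int n}. P S \<and> Q S}) / real (card {S \<in> Pow {0..int n}. Q S})"
proof -
  have "\<P>(S in measure_pmf (random_subset n). R S)
      = real (card {S \<in> Pow {0..int n}. R S}) / real (card (Pow {0..int n}))" for R
  proof -
    have "Pow {0..int n} \<inter> {S. R S} = {S \<in> Pow {0..int n}. R S}" by blast
    then show ?thesis unfolding random_subset_def
      by (subst measure_pmf_of_set) auto
  qed
  then show ?thesis by (simp add: cond_prob_def card_Pow)
qed

theorem corollary5p5:
  fixes \<Lambda> :: "(int \<times> int) set" and \<alpha> k :: "nat \<Rightarrow> int"
  assumes "\<Lambda> \<subseteq> {0..} \<times> {0..}"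
    and "\<exists>(s, d) \<in> \<Lambda>. even d"
    and "eventually (\<lambda>n. 0 < \<alpha> n \<and> real_of_int (\<alpha> n) < real n / 2) sequentially"
    and "filterlim \<alpha> at_top sequentially"
    and "eventually (\<lambda>n. \<alpha> n < k n \<and> k n < int n - \<alpha> n) sequentially"
  shows "(\<lambda>n. \<P>(S in measure_pmf (random_subset n). k n \<in> S \<bar> lambda_pair n S \<in> \<Lambda>))
           \<longlonglongrightarrow> 1 / 2"
proof -
  obtain s d where sd: "(s, d) \<in> \<Lambda>" "even d" using assms(2) by auto
  then have "0 \<le> s" "0 \<le> d" using assms(1) by auto
  \<comment> \<open>Evenness of \<open>d\<close> enters here: fringes realise second entries of the
    form \<open>2 * t\<close>.\<close>
  then obtain s' t where st: "(int s', 2 * int t) \<in> \<Lambda>"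
    using sd by (metis evenE nonneg_int_cases zero_le_mult_iff zero_less_numeral not_less)
  obtain A B where "fringe_pair s' t A B" using fringe_pair_exists by blast
  then obtain \<delta> :: real where \<delta>: "\<delta> > 0" and ev: "\<forall>\<^sub>F n in sequentially.
    \<delta> * 2 ^ (n + 1) \<le> real (card {S \<in> Pow {0..int n}. lambda_pair n S = (int s', 2 * int t)})"
    using card_lambda_pair_eq_ge by blast
  let ?p = "\<lambda>n. \<P>(S in measure_pmf (random_subset n). k n \<in> S \<bar> lambda_pair n S \<in> \<Lambda>)"
  \<comment> \<open>The 12 is 24/2: 24 bounds the unfilled sets, and the deviation from 1/2 is half
    of the relative imbalance. The \<open>\<delta>\<close> comes from the lower bound on
    \<open>card W\<close>.\<close>
  have "\<forall>\<^sub>F n in sequentially. norm (?p n - 1/2) \<le> 12 / \<delta> * (7/8) ^ nat (\<alpha> n)"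
    using ev assms(3,5)
  proof eventually_elim
    case (elim n)
    define X where "X = {S \<in> Pow {0..int n}. k n \<in> S \<and> lambda_pair n S \<in> \<Lambda>}"
    define Y where "Y = {S \<in> Pow {0..int n}. k n \<notin> S \<and> lambda_pair n S \<in> \<Lambda>}"
    define W where "W = {S \<in> Pow {0..int n}. lambda_pair n S \<in> \<Lambda>}"
    define b where "b = real (card {S \<in> Pow {0..int n}. \<not> fills (int n) (\<alpha> n) S})"
    have "X \<union> Y = W" "X \<inter> Y = {}" "finite X" "finite Y" by (auto simp: X_def Y_def W_def)
    then have W: "real (card W) = real (card X) + real (card Y)" using card_Un_disjoint by force
    have "b \<le> 24 * (7/8) ^ nat (\<alpha> n) * 2 ^ nat (int n + 1)"
      unfolding b_def using elim by (intro card_not_fills_le) auto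
    also have "nat (int n + 1) = n + 1" by simp
    finally have b: "b \<le> 24 * (7/8) ^ nat (\<alpha> n) * 2 ^ (n + 1)" .
    have XY: "\<bar>real (card X) - real (card Y)\<bar> \<le> b"
      unfolding X_def Y_def b_def using elim by (intro card_lambda_pair_balance) auto
    have "card {S \<in> Pow {0..int n}. lambda_pair n S = (int s', 2 * int t)} \<le> card W"
      unfolding W_def using st by (intro card_mono) auto
    then have Wge: "\<delta> * 2 ^ (n + 1) \<le> real (card W)" using elim by linarith
    moreover have "0 < \<delta> * 2 ^ (n + 1)" using \<delta> by simp
    ultimately have Wpos: "0 < real (card W)" by linarith
    have "?p n = real (card X) / real (card W)" by (simp add: cond_prob_random_subset X_def W_def)
    \<comment> \<open>\<open>X\<close> and \<open>Y\<close> partition \<open>W\<close>, so 1/2 is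
      \<open>(card X + card Y) / (2 * card W)\<close>.\<close>
    then have "?p n - 1/2 = (real (card X) - real (card Y)) / (2 * real (card W))"
      using Wpos W by (simp add: field_simps)
    then have "norm (?p n - 1/2) = \<bar>real (card X) - real (card Y)\<bar> / (2 * real (card W))" by simp
    also have "\<dots> \<le> (24 * (7/8) ^ nat (\<alpha> n) * 2 ^ (n + 1)) / (2 * (\<delta> * 2 ^ (n + 1)))"
      using XY b Wge \<delta> by (intro frac_le) auto
    also have "\<dots> = 12 / \<delta> * (7/8) ^ nat (\<alpha> n)" using \<delta> by (simp add: field_simps)
    finally show ?case .
  qed
  moreover have "(\<lambda>n. 12 / \<delta> * (7/8) ^ nat (\<alpha> n)) \<longlonglongrightarrow> 0"
  proof -
    have "filterlim (\<lambda>n. nat (\<alpha> n)) at_top sequentially"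
      using filterlim_compose[OF filterlim_nat_sequentially assms(4)] .
    then have "(\<lambda>n. (7/8::real) ^ nat (\<alpha> n)) \<longlonglongrightarrow> 0"
      by (intro filterlim_compose[OF LIMSEQ_realpow_zero]) auto
    then show ?thesis by (rule tendsto_mult_right_zero)
  qed
  ultimately have "(\<lambda>n. ?p n - 1/2) \<longlonglongrightarrow> 0" by (rule Lim_null_comparison)
  then show ?thesis by (simp add: LIM_zero_iff)
qed

end
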